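(* Let $\lambda$ be a nonzero real number and let $f, g:\mathbb{R}\to\mathbb{C}$ be arbitrary functions. For any positive integer $r$, $$\delta_{\lambda}^{r}(fg)=\sum_{l=0}^{r}\lambda^{r-l}\binom{r}{l}\sum_{k=0}^{l}\binom{l}{k}\,(\delta_{\lambda}^{r-k}f)\,(\delta_{\lambda}^{k+r-l}g)$$ as functions on $\mathbb{R}$.
   Context: For a nonzero real number $\lambda$ and a function $f:\mathbb{R}\to\mathbb{C}$, the difference quotient of $f$ is the function $\delta_{\lambda}f:\mathbb{R}\to\mathbb{C}$ given by $(\delta_{\lambda}f)(x)=\frac{f(x+\lambda)-f(x)}{\lambda}$. For a nonnegative integer $m$, $\delta_{\lambda}^{m}$ denotes the $m$-fold iterate of the operator $\delta_{\lambda}$, with $\delta_{\lambda}^{0}$ the identity. Products of functions are pointwise. *)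

theory Defs
  imports Complex_Main
begin

definition diff_quot :: "real \<Rightarrow> (real \<Rightarrow> complex) \<Rightarrow> (real \<Rightarrow> complex)" where
  "diff_quot lam f = (\<lambda>x. (f (x + lam) - f x) / complex_of_real lam)"

end

theory Submission
  imports Defs
begin

text \<open>On products, \<open>\<delta>\<close> acts as \<open>A + B + \<lambda>AB\<close>, where the commuting operators \<open>A\<close> and \<open>B\<close> apply
  \<open>\<delta>\<close> to the first and to the second factor. The formula is the binomial expansion of
  \<open>((A + B) + \<lambda>AB)^r\<close> followed by that of \<open>(A + B)^l\<close>; both are carried out by induction
  through Pascal's rule.\<close>

text \<open>Pascal's rule with an arbitrary weight \<open>F\<close>, so that it serves both the
  outer sum over \<open>l\<close> and the inner sum over \<open>k\<close>.\<close>

lemma sum_choose_Suc: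
  fixes F :: "nat \<Rightarrow> 'a::comm_semiring_1"
  shows "(\<Sum>l=0..Suc n. of_nat (Suc n choose l) * F l) =
    (\<Sum>l=0..n. of_nat (n choose l) * (F l + F (Suc l)))"
proof -
  have "(\<Sum>l=0..n. of_nat (n choose Suc l) * F (Suc l)) + F 0 =
      (\<Sum>l=0..Suc n. of_nat (n choose l) * F l)"
    unfolding atLeast0AtMost sum.atMost_Suc_shift by (simp add: add.commute)
  \<comment> \<open>The top term \<open>l = Suc n\<close> vanishes, since
    \<open>n choose Suc n\<close> is 0.\<close>
  also have "\<dots> = (\<Sum>l=0..n. of_nat (n choose l) * F l)"
    by (simp add: atLeast0AtMost binomial_eq_0)
  finally have *: "(\<Sum>l=0..n. of_nat (n choose Suc l) * F (Suc l)) + F 0 =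
      (\<Sum>l=0..n. of_nat (n choose l) * F l)" .
  have "(\<Sum>l=0..Suc n. of_nat (Suc n choose l) * F l) =
      (\<Sum>l=0..n. of_nat (n choose l) * F (Suc l)) +
      ((\<Sum>l=0..n. of_nat (n choose Suc l) * F (Suc l)) + F 0)"
    unfolding atLeast0AtMost sum.atMost_Suc_shift
    by (simp add: sum.distrib algebra_simps)
  then show ?thesis
    unfolding * by (simp add: sum.distrib algebra_simps)
qed

lemma diff_quot_sum:
  "diff_quot lam (\<lambda>x. \<Sum>i\<in>I. h i x) = (\<lambda>x. \<Sum>i\<in>I. diff_quot lam (h i) x)"
  by (simp add: diff_quot_def sum_divide_distrib flip: sum_subtractf)

lemma diff_quot_cmult:
  "diff_quot lam (\<lambda>x. c * h x) = (\<lambda>x. c * diff_quot lam h x)"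
  by (simp add: diff_quot_def right_diff_distrib)

lemma diff_quot_mult:
  assumes "lam \<noteq> 0"
  shows "diff_quot lam (\<lambda>x. f x * g x) = (\<lambda>x. diff_quot lam f x * g x + f x * diff_quot lam g x
    + complex_of_real lam * (diff_quot lam f x * diff_quot lam g x))"
  using assms by (simp add: diff_quot_def fun_eq_iff field_simps)

text \<open>Each binomial coefficient stands leftmost, the shape in which
  \<open>sum_choose_Suc\<close> applies; the induction starts at \<open>r = 0\<close>.\<close>

lemma funpow_diff_quot_mult:
  fixes lam :: real and f g :: "real \<Rightarrow> complex" and r :: nat
  assumes "lam \<noteq> 0"
  shows "(diff_quot lam ^^ r) (\<lambda>x. f x * g x) =
    (\<lambda>x. \<Sum>l=0..r. of_nat (r choose l) * (complex_of_real lam ^ (r - l) *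
      (\<Sum>k=0..l. of_nat (l choose k) *
        ((diff_quot lam ^^ (r - k)) f x * (diff_quot lam ^^ (k + r - l)) g x))))"
proof (induction r)
  case 0
  show ?case by simp
next
  case (Suc r)
  \<comment> \<open>\<open>T a b\<close> is \<open>A^a B^b\<close> applied to the pair
    \<open>f\<close>, \<open>g\<close>; \<open>F r l\<close> below is
    \<open>(\<lambda>AB)^(r-l) (A+B)^l\<close> applied to it.\<close>
  define T where "T a b x = (diff_quot lam ^^ a) f x * (diff_quot lam ^^ b) g x" for a b x
  define F where "F r l x = complex_of_real lam ^ (r - l) *
    (\<Sum>k=0..l. of_nat (l choose k) * T (r - k) (k + r - l) x)" for r l x
  have T: "diff_quot lam (T a b) x =
      T (Suc a) b x + T a (Suc b) x + complex_of_real lam * T (Suc a) (Suc b) x" for a b x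
    unfolding T_def diff_quot_mult[OF assms] by simp
  \<comment> \<open>The summand \<open>\<lambda>AB\<close> raises only \<open>r\<close>, while
    \<open>A + B\<close> raises both \<open>r\<close> and \<open>l\<close>. The bound
    \<open>l \<le> r\<close> keeps the truncated subtractions exact.\<close>
  have step: "diff_quot lam (F r l) x = F (Suc r) l x + F (Suc r) (Suc l) x" if "l \<le> r" for l x
  proof -
    let ?S = "\<lambda>G. \<Sum>k=0..l. of_nat (l choose k) * G k"
    \<comment> \<open>The additional factor \<open>\<lambda>\<close> of
      \<open>\<lambda>^(Suc r - l)\<close> moves into the sum.\<close>
    have l: "F (Suc r) l x = complex_of_real lam ^ (r - l) *
        ?S (\<lambda>k. complex_of_real lam * T (Suc (r - k)) (Suc (k + r - l)) x)"
      using that unfolding F_def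
      by (auto simp: Suc_diff_le sum_distrib_left mult_ac intro!: sum.cong)
    \<comment> \<open>Here the power of \<open>\<lambda>\<close> stays \<open>r - l\<close>;
      Pascal's rule on the inner sum yields an \<open>A\<close> term from index \<open>k\<close> and
      a \<open>B\<close> term from \<open>Suc k\<close>.\<close>
    have "F (Suc r) (Suc l) x = complex_of_real lam ^ (r - l) *
        ?S (\<lambda>k. T (Suc r - k) (k + Suc r - Suc l) x + T (Suc r - Suc k) (Suc k + Suc r - Suc l) x)"
      unfolding F_def sum_choose_Suc by simp
    also have "\<dots> = complex_of_real lam ^ (r - l) *
        ?S (\<lambda>k. T (Suc (r - k)) (k + r - l) x + T (r - k) (Suc (k + r - l)) x)"
      using that by (auto simp: Suc_diff_le intro!: sum.cong)
    finally have Sl: "F (Suc r) (Suc l) x = \<dots>" .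
    have "diff_quot lam (F r l) x = complex_of_real lam ^ (r - l) *
        ?S (\<lambda>k. diff_quot lam (T (r - k) (k + r - l)) x)"
      unfolding F_def diff_quot_cmult diff_quot_sum ..
    then show ?thesis
      unfolding l Sl T by (simp add: sum.distrib distrib_left)
  qed
  have "(diff_quot lam ^^ Suc r) (\<lambda>x. f x * g x) =
      diff_quot lam (\<lambda>x. \<Sum>l=0..r. of_nat (r choose l) * F r l x)"
    by (simp add: Suc F_def T_def)
  also have "\<dots> = (\<lambda>x. \<Sum>l=0..r. of_nat (r choose l) * diff_quot lam (F r l) x)"
    unfolding diff_quot_sum diff_quot_cmult ..
  also have "\<dots> = (\<lambda>x. \<Sum>l=0..r. of_nat (r choose l) * (F (Suc r) l x + F (Suc r) (Suc l) x))"
    by (simp add: step)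
  \<comment> \<open>Pascal's rule again, read from right to left on the outer sum.\<close>
  also have "\<dots> = (\<lambda>x. \<Sum>l=0..Suc r. of_nat (Suc r choose l) * F (Suc r) l x)"
    unfolding sum_choose_Suc ..
  finally show ?case
    unfolding F_def T_def .
qed

theorem theorem1p1:
  fixes lam :: real and f g :: "real \<Rightarrow> complex" and r :: nat
  assumes "lam \<noteq> 0" and "r > 0"
  shows "(diff_quot lam ^^ r) (\<lambda>x. f x * g x) =
    (\<lambda>x. \<Sum>l=0..r. complex_of_real lam ^ (r - l) * of_nat (r choose l) *
      (\<Sum>k=0..l. of_nat (l choose k) *
        (diff_quot lam ^^ (r - k)) f x * (diff_quot lam ^^ (k + r - l)) g x))"
  unfolding funpow_diff_quot_mult[OF assms(1)] by (simp add: mult_ac)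

end
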